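(* Single-sample OSO can yield unbounded benefits versus the mean-based certainty-equivalent (CE) resolving heuristic: for every $M>0$ there is an instance of the online resource allocation problem for which the expected total reward of the mean-based CE heuristic is positive and the expected total reward of the single-sample OSO algorithm (run with an equivariant solver) is at least $M$ times the expected total reward of the mean-based CE heuristic.
   Context: Online resource allocation problem. There are $m$ supply nodes ($j\in\mathcal{J}=\{1,\dots,m\}$) and $d$ resources ($k\in\mathcal{K}=\{1,\dots,d\}$); resource $k$ has deterministic capacity $b_k\ge 0$, and $b=(b_1,\dots,b_d)$. Items $t=1,\dots,T$ arrive one at a time. Item $t$ is described by $\xi^t=(r^t,A^t)$, where $r^t\in\mathbb{R}^m$ is a vector of rewards and $A^t\in\mathbb{R}_{\ge 0}^{m\times d}$ is a matrix of resource consumptions. The $\xi^1,\dots,\xi^T$ are i.i.d. from a known distribution $\mathcal{D}$ (with integrable rewards and consumptions). Let $\Delta=\{x\in\{0,1\}^m:\sum_{j}x_j\le 1\}$. An instance consists of $T,m,d,b,\mathcal{D}$. An online algorithm chooses $\overline x^t\in\Delta$ irrevocably after observing $\xi^1,\dots,\xi^t$, subject to $\sum_{\tau\le t}(A^\tau)^\top\overline x^\tau\le b$; its total reward is $\sum_{t=1}^T r^t\cdot\overline x^t$. Single-sample OSO algorithm. For $t=1,\dots,T$: observe $\xi^t$; draw one fresh sample path $\widetilde\xi^{t+1}_t,\dots,\widetilde\xi^{T}_t$, with $\widetilde\xi^\tau_t=(\widetilde r^\tau_t,\widetilde A^\tau_t)$, i.i.d. from $\mathcal{D}$ and independent of everything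 else; use the solver to compute an optimal solution $(\widetilde x^t,\dots,\widetilde x^T)$ of $$\max\Big\{ r^t\cdot x^t+\sum_{\tau=t+1}^T \widetilde r^\tau_t\cdot x^\tau : \sum_{\tau=1}^{t-1}(A^\tau)^\top\overline x^\tau+(A^t)^\top x^t+\sum_{\tau=t+1}^T(\widetilde A^\tau_t)^\top x^\tau\le b,\; x^t,\dots,x^T\in\Delta\Big\};$$ implement $\overline x^t=\widetilde x^t$ and discard the rest. Equivariant solver. An exact solver for integer programs $\max\{\sum_{i=1}^s r^i\cdot x^i:\sum_{i=1}^s (A^i)^\top x^i\le b',\,x^i\in\Delta\}$ is equivariant if permuting the items permutes the solution in the same way: if it returns $(x^1,\dots,x^s)$ on the list of items $(r^1,A^1),\dots,(r^s,A^s)$, then for every permutation $\pi$ of $\{1,\dots,s\}$ it returns $(x^{\pi(1)},\dots,x^{\pi(s)})$ on the list $(r^{\pi(1)},A^{\pi(1)}),\dots,(r^{\pi(s)},A^{\pi(s)})$. The solver may use internal randomness (fresh and independent at each call, e.g. to break ties between identical items), in which case this is understood as equality in distribution. Mean-based CE resolving heuristic. Same as single-sample OSO, except that every sampled pair $(\widetilde r^\tau_t,\widetilde A^\tau_t)$ is replaced by the mean $(\mathbb{E}[r^\tau],\mathbb{E}[A^\tau])$: at each $t$ it computes an optimal solution $(\widetilde x^t,\dots,\widetilde x^T)$ of $$\max\Big\{ r^t\cdot x^t+\sum_{\tau=t+1}^T \mathbb{E}[r^\tau]\cdot x^\tau : \sum_{\tau=1}^{t-1}(A^\tau)^\top\overline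 x^\tau+(A^t)^\top x^t+\sum_{\tau=t+1}^T\mathbb{E}[A^\tau]^\top x^\tau\le b,\; x^t,\dots,x^T\in\Delta\Big\}$$ and implements $\overline x^t=\widetilde x^t$. *)

theory Defs
  imports "HOL-Probability.Probability"
begin

text \<open>
  All dimensions are natural numbers, and vectors and matrices are extensional functions on
  \<open>{1..n}\<close>: an item is a pair \<open>(r, A)\<close> with rewards \<open>r j\<close> and consumptions \<open>A j k\<close>, where
  \<open>j \<in> {1..m}\<close> and \<open>k \<in> {1..d}\<close>.
\<close>

type_synonym item = "(nat \<Rightarrow> real) \<times> (nat \<Rightarrow> nat \<Rightarrow> real)"

definition capacity_space :: "nat \<Rightarrow> (nat \<Rightarrow> real) measure" where
  "capacity_space d = (\<Pi>\<^sub>M k\<in>{1..d}. restrict_space borel {0..})"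

definition item_space :: "nat \<Rightarrow> nat \<Rightarrow> item measure" where
  "item_space m d =
     (\<Pi>\<^sub>M j\<in>{1..m}. borel) \<Otimes>\<^sub>M (\<Pi>\<^sub>M j\<in>{1..m}. \<Pi>\<^sub>M k\<in>{1..d}. restrict_space borel {0..})"

definition online_instance ::
  "nat \<Rightarrow> nat \<Rightarrow> nat \<Rightarrow> (nat \<Rightarrow> real) \<Rightarrow> item measure \<Rightarrow> bool" where
  "online_instance T m d b D \<longleftrightarrow>
     1 \<le> T \<and> 1 \<le> m \<and> 1 \<le> d \<and> b \<in> space (capacity_space d) \<and>
     prob_space D \<and> sets D = sets (item_space m d) \<and>
     (\<forall>j\<in>{1..m}. integrable D (\<lambda>\<xi>. fst \<xi> j)) \<and>
     (\<forall>j\<in>{1..m}. \<forall>k\<in>{1..d}. integrable D (\<lambda>\<xi>. snd \<xi> j k))"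

definition Delta :: "nat \<Rightarrow> (nat \<Rightarrow> real) set" where
  "Delta m = {x \<in> {1..m} \<rightarrow>\<^sub>E {0, 1}. (\<Sum>j=1..m. x j) \<le> 1}"

definition reward :: "nat \<Rightarrow> item \<Rightarrow> (nat \<Rightarrow> real) \<Rightarrow> real" where
  "reward m \<xi> x = (\<Sum>j=1..m. fst \<xi> j * x j)"

definition consumption :: "nat \<Rightarrow> item \<Rightarrow> (nat \<Rightarrow> real) \<Rightarrow> nat \<Rightarrow> real" where
  "consumption m \<xi> x k = (\<Sum>j=1..m. snd \<xi> j k * x j)"

subsection \<open>Integer programs and solvers\<close>

definition feasible ::
  "nat \<Rightarrow> nat \<Rightarrow> nat \<Rightarrow> (nat \<Rightarrow> real) \<Rightarrow> (nat \<Rightarrow> item) \<Rightarrow> (nat \<Rightarrow> nat \<Rightarrow> real) set" where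
  "feasible m d s c \<xi> =
     {x \<in> {1..s} \<rightarrow>\<^sub>E Delta m. \<forall>k\<in>{1..d}. (\<Sum>i=1..s. consumption m (\<xi> i) (x i) k) \<le> c k}"

definition optimal ::
  "nat \<Rightarrow> nat \<Rightarrow> nat \<Rightarrow> (nat \<Rightarrow> real) \<Rightarrow> (nat \<Rightarrow> item) \<Rightarrow> (nat \<Rightarrow> nat \<Rightarrow> real) set" where
  "optimal m d s c \<xi> =
     {x \<in> feasible m d s c \<xi>. \<forall>y\<in>feasible m d s c \<xi>.
        (\<Sum>i=1..s. reward m (\<xi> i) (y i)) \<le> (\<Sum>i=1..s. reward m (\<xi> i) (x i))}"

text \<open>
  A solver maps the number of items \<open>s\<close>, the capacities and the items \<open>\<xi> 1, \<dots>, \<xi> s\<close> to the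
  distribution of the solution it returns; a deterministic solver returns point masses.
  Consumptions are nonnegative, so the programs with nonnegative capacities are exactly the
  feasible ones. The measurability condition makes the solver's output a random variable
  when its input is random.
\<close>

type_synonym solver =
  "nat \<Rightarrow> (nat \<Rightarrow> real) \<Rightarrow> (nat \<Rightarrow> item) \<Rightarrow> (nat \<Rightarrow> nat \<Rightarrow> real) pmf"

definition exact_solver :: "nat \<Rightarrow> nat \<Rightarrow> solver \<Rightarrow> bool" where
  "exact_solver m d \<sigma> \<longleftrightarrow>
     (\<forall>s. \<forall>c\<in>space (capacity_space d). \<forall>\<xi>\<in>space (\<Pi>\<^sub>M i\<in>{1..s}. item_space m d).
        set_pmf (\<sigma> s c \<xi>) \<subseteq> optimal m d s c \<xi>) \<and>
     (\<forall>s x. (\<lambda>(c, \<xi>). pmf (\<sigma> s c \<xi>) x)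
        \<in> borel_measurable (capacity_space d \<Otimes>\<^sub>M (\<Pi>\<^sub>M i\<in>{1..s}. item_space m d)))"

definition equivariant_solver :: "nat \<Rightarrow> nat \<Rightarrow> solver \<Rightarrow> bool" where
  "equivariant_solver m d \<sigma> \<longleftrightarrow>
     exact_solver m d \<sigma> \<and>
     (\<forall>s. \<forall>c\<in>space (capacity_space d). \<forall>\<xi>\<in>space (\<Pi>\<^sub>M i\<in>{1..s}. item_space m d).
        \<forall>\<pi>. \<pi> permutes {1..s} \<longrightarrow>
          \<sigma> s c (\<lambda>i\<in>{1..s}. \<xi> (\<pi> i)) = map_pmf (\<lambda>x. \<lambda>i\<in>{1..s}. x (\<pi> i)) (\<sigma> s c \<xi>))"


text \<open>
  An equivariant solver exists, hence quantifying over such solvers is not vacuous: return an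
  optimal solution chosen uniformly at random.
\<close>

lemma finite_Delta: "finite (Delta m)"
  unfolding Delta_def by (rule finite_subset[of _ "{1..m} \<rightarrow>\<^sub>E {0, 1}"]) (auto intro: finite_PiE)

lemma finite_feasible: "finite (feasible m d s c \<xi>)"
  unfolding feasible_def
  by (rule finite_subset[of _ "{1..s} \<rightarrow>\<^sub>E Delta m"]) (auto intro: finite_PiE finite_Delta)

lemma finite_optimal: "finite (optimal m d s c \<xi>)"
  unfolding optimal_def by (rule finite_subset[OF _ finite_feasible]) auto

lemma optimal_nonempty:
  assumes "c \<in> space (capacity_space d)"
  shows "optimal m d s c \<xi> \<noteq> {}"
proof -
  have "(\<lambda>i\<in>{1..s}. \<lambda>j\<in>{1..m}. 0) \<in> feasible m d s c \<xi>"
    using assms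
    by (auto simp: feasible_def Delta_def consumption_def capacity_space_def space_PiM
        space_restrict_space)
  then have ne: "feasible m d s c \<xi> \<noteq> {}" by blast
  let ?f = "\<lambda>x. \<Sum>i=1..s. reward m (\<xi> i) (x i)"
  have "Max (?f ` feasible m d s c \<xi>) \<in> ?f ` feasible m d s c \<xi>"
    by (rule Max_in) (use ne finite_feasible in auto)
  then obtain x where x: "x \<in> feasible m d s c \<xi>" "?f x = Max (?f ` feasible m d s c \<xi>)" by force
  have "?f y \<le> ?f x" if "y \<in> feasible m d s c \<xi>" for y
    unfolding x(2) by (rule Max_ge) (use that finite_feasible in auto)
  then show ?thesis using x(1) by (auto simp: optimal_def)
qed

lemma measurable_optimal:
  "Measurable.pred (capacity_space d \<Otimes>\<^sub>M (\<Pi>\<^sub>M i\<in>{1..s}. item_space m d))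
     (\<lambda>(c, \<xi>). x \<in> optimal m d s c \<xi>)"
proof -
  let ?N = "capacity_space d \<Otimes>\<^sub>M (\<Pi>\<^sub>M i\<in>{1..s}. item_space m d)"
  have item: "(\<lambda>p. snd p i) \<in> ?N \<rightarrow>\<^sub>M item_space m d" if "i \<in> {1..s}" for i
    using that by measurable
  have rew: "(\<lambda>p. fst (snd p i) j) \<in> borel_measurable ?N" if "i \<in> {1..s}" "j \<in> {1..m}" for i j
    using measurable_compose[OF measurable_compose[OF item[OF that(1), unfolded item_space_def]
        measurable_fst] measurable_component_singleton[OF that(2)]]
    by (simp add: item_space_def)
  have con: "(\<lambda>p. snd (snd p i) j k) \<in> borel_measurable ?N"
    if "i \<in> {1..s}" "j \<in> {1..m}" "k \<in> {1..d}" for i j k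
    using measurable_compose[OF measurable_compose[OF measurable_compose[OF
        item[OF that(1), unfolded item_space_def] measurable_snd]
        measurable_component_singleton[OF that(2)]] measurable_component_singleton[OF that(3)]]
    by (simp add: item_space_def measurable_restrict_space2_iff)
  have cap: "(\<lambda>p. fst p k) \<in> borel_measurable ?N" if "k \<in> {1..d}" for k
    using measurable_compose[OF measurable_fst[of "capacity_space d"
        "\<Pi>\<^sub>M i\<in>{1..s}. item_space m d", unfolded capacity_space_def]
        measurable_component_singleton[OF that]]
    by (simp add: capacity_space_def measurable_restrict_space2_iff)
  have R: "(\<lambda>p. \<Sum>i=1..s. reward m (snd p i) (y i)) \<in> borel_measurable ?N" for y
    unfolding reward_def by (intro borel_measurable_sum borel_measurable_times rew) auto
  have C: "(\<lambda>p. \<Sum>i=1..s. consumption m (snd p i) (y i) k) \<in> borel_measurable ?N"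
    if "k \<in> {1..d}" for y k
    unfolding consumption_def using that
    by (intro borel_measurable_sum borel_measurable_times con) auto
  have le: "Measurable.pred ?N (\<lambda>p. F p \<le> G p)"
    if "F \<in> borel_measurable ?N" "G \<in> borel_measurable ?N" for F G :: "_ \<Rightarrow> real"
    using that by measurable
  have feas: "Measurable.pred ?N (\<lambda>p. y \<in> feasible m d s (fst p) (snd p))" for y
  proof -
    have "Measurable.pred ?N (\<lambda>p. y \<in> {1..s} \<rightarrow>\<^sub>E Delta m \<and>
        (\<forall>k\<in>{1..d}. (\<Sum>i=1..s. consumption m (snd p i) (y i) k) \<le> fst p k))"
      by (intro pred_intros_logic pred_intros_finite le C cap) auto
    then show ?thesis by (simp add: feasible_def)
  qed
  have "Measurable.pred ?N (\<lambda>p. x \<in> feasible m d s (fst p) (snd p) \<and>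
      (\<forall>y\<in>{1..s} \<rightarrow>\<^sub>E Delta m. y \<in> feasible m d s (fst p) (snd p) \<longrightarrow>
        (\<Sum>i=1..s. reward m (snd p i) (y i)) \<le> (\<Sum>i=1..s. reward m (snd p i) (x i))))"
    by (intro pred_intros_logic pred_intros_finite le R feas)
      (auto intro: finite_PiE finite_Delta)
  moreover have "x \<in> optimal m d s c \<xi> \<longleftrightarrow> x \<in> feasible m d s c \<xi> \<and>
      (\<forall>y\<in>{1..s} \<rightarrow>\<^sub>E Delta m. y \<in> feasible m d s c \<xi> \<longrightarrow>
        (\<Sum>i=1..s. reward m (\<xi> i) (y i)) \<le> (\<Sum>i=1..s. reward m (\<xi> i) (x i)))" for c \<xi>
    by (auto simp: optimal_def feasible_def)
  ultimately show ?thesis by (simp add: case_prod_beta)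
qed

lemma optimal_cong:
  assumes "\<And>i. i \<in> {1..s} \<Longrightarrow> \<xi> i = \<xi>' i"
  shows "optimal m d s c \<xi> = optimal m d s c \<xi>'"
proof -
  have C: "(\<Sum>i=1..s. consumption m (\<xi> i) (x i) k) = (\<Sum>i=1..s. consumption m (\<xi>' i) (x i) k)" for x k
    by (rule sum.cong) (simp_all only: assms)
  have R: "(\<Sum>i=1..s. reward m (\<xi> i) (x i)) = (\<Sum>i=1..s. reward m (\<xi>' i) (x i))" for x
    by (rule sum.cong) (simp_all only: assms)
  show ?thesis unfolding optimal_def feasible_def C R ..
qed

lemma optimal_permute:
  assumes "\<pi> permutes {1..s}"
  shows "optimal m d s c (\<lambda>i\<in>{1..s}. \<xi> (\<pi> i)) =
    (\<lambda>x. \<lambda>i\<in>{1..s}. x (\<pi> i)) ` optimal m d s c \<xi>"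
    (is "?L = ?g \<pi> ` ?R")
proof -
  have img: "?g p x \<in> optimal m d s c (\<lambda>i\<in>{1..s}. \<xi> (p i))"
    if p: "p permutes {1..s}" and x: "x \<in> optimal m d s c \<xi>" for p x \<xi>
  proof -
    have pin: "p i \<in> {1..s} \<longleftrightarrow> i \<in> {1..s}" for i using permutes_in_image[OF p] by blast
    have ipin: "inv p i \<in> {1..s} \<longleftrightarrow> i \<in> {1..s}" for i
      using permutes_in_image[OF permutes_inv[OF p]] by blast
    have shift: "(\<Sum>i=1..s. F (p i)) = (\<Sum>i=1..s. F i)" for F :: "nat \<Rightarrow> real"
      using sum.permute[OF p, of F] by (simp add: comp_def)
    have fe: "?g p z \<in> feasible m d s c (\<lambda>i\<in>{1..s}. \<xi> (p i))"
      if "z \<in> feasible m d s c \<xi>" for z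
      using that shift[of "\<lambda>i. consumption m (\<xi> i) (z i) k" for k] pin
      by (auto simp: feasible_def PiE_def Pi_def extensional_def simp del: atLeastAtMost_iff)
    have "(\<Sum>i=1..s. reward m ((\<lambda>i\<in>{1..s}. \<xi> (p i)) i) (y i)) \<le>
        (\<Sum>i=1..s. reward m ((\<lambda>i\<in>{1..s}. \<xi> (p i)) i) (?g p x i))"
      if y: "y \<in> feasible m d s c (\<lambda>i\<in>{1..s}. \<xi> (p i))" for y
    proof -
      define z where "z = ?g (inv p) y"
      have zp: "z (p i) = y i" if "i \<in> {1..s}" for i
        using that pin permutes_inverses[OF p] by (simp add: z_def del: atLeastAtMost_iff)
      have "(\<Sum>i=1..s. consumption m (\<xi> i) (z i) k) =
          (\<Sum>i=1..s. consumption m (\<xi> (p i)) (y i) k)" for k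
        unfolding shift[of "\<lambda>i. consumption m (\<xi> i) (z i) k", symmetric]
        by (rule sum.cong) (simp_all add: zp)
      moreover have "z \<in> {1..s} \<rightarrow>\<^sub>E Delta m"
        using y ipin
        by (auto simp: feasible_def PiE_def Pi_def extensional_def z_def
            simp del: atLeastAtMost_iff)
      moreover have "(\<Sum>i=1..s. consumption m ((\<lambda>i\<in>{1..s}. \<xi> (p i)) i) (y i) k) =
          (\<Sum>i=1..s. consumption m (\<xi> (p i)) (y i) k)" for k
        by (rule sum.cong) simp_all
      ultimately have "z \<in> feasible m d s c \<xi>"
        using y by (simp add: feasible_def)
      then have "(\<Sum>i=1..s. reward m (\<xi> i) (z i)) \<le> (\<Sum>i=1..s. reward m (\<xi> i) (x i))"
        using x by (auto simp: optimal_def)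
      moreover have "(\<Sum>i=1..s. reward m ((\<lambda>i\<in>{1..s}. \<xi> (p i)) i) (y i)) =
          (\<Sum>i=1..s. reward m (\<xi> (p i)) (z (p i)))"
        by (rule sum.cong) (simp_all add: zp)
      moreover have "(\<Sum>i=1..s. reward m ((\<lambda>i\<in>{1..s}. \<xi> (p i)) i) (?g p x i)) =
          (\<Sum>i=1..s. reward m (\<xi> (p i)) (x (p i)))"
        by (rule sum.cong) simp_all
      ultimately show ?thesis
        using shift[of "\<lambda>i. reward m (\<xi> i) (z i)"] shift[of "\<lambda>i. reward m (\<xi> i) (x i)"]
        by simp
    qed
    then show ?thesis using fe x by (auto simp: optimal_def)
  qed
  have "y \<in> ?g \<pi> ` ?R" if y: "y \<in> ?L" for y
  proof
    have pin: "\<pi> i \<in> {1..s} \<longleftrightarrow> i \<in> {1..s}" for i using permutes_in_image[OF assms] by blast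
    have ipin: "inv \<pi> i \<in> {1..s} \<longleftrightarrow> i \<in> {1..s}" for i
      using permutes_in_image[OF permutes_inv[OF assms]] by blast
    have "y \<in> extensional {1..s}"
      using y by (auto simp: optimal_def feasible_def PiE_def)
    then show "y = ?g \<pi> (?g (inv \<pi>) y)"
      using pin permutes_inverses[OF assms]
      by (auto simp: fun_eq_iff extensional_def simp del: atLeastAtMost_iff)
    have "?g (inv \<pi>) y \<in> optimal m d s c (\<lambda>i\<in>{1..s}. (\<lambda>i\<in>{1..s}. \<xi> (\<pi> i)) (inv \<pi> i))"
      by (rule img[OF permutes_inv[OF assms] y])
    also have "optimal m d s c (\<lambda>i\<in>{1..s}. (\<lambda>i\<in>{1..s}. \<xi> (\<pi> i)) (inv \<pi> i)) = ?R"
      by (rule optimal_cong) (use ipin permutes_inverses[OF assms] in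
          \<open>simp del: atLeastAtMost_iff\<close>)
    finally show "?g (inv \<pi>) y \<in> ?R" .
  qed
  then show ?thesis using img[OF assms] by blast
qed

lemma equivariant_solver_exists: "\<exists>\<sigma>. equivariant_solver m d \<sigma>"
proof
  let ?\<sigma> = "\<lambda>s c \<xi>. pmf_of_set (optimal m d s c \<xi>)"
  have "(\<lambda>(c, \<xi>). pmf (?\<sigma> s c \<xi>) x)
      \<in> borel_measurable (capacity_space d \<Otimes>\<^sub>M (\<Pi>\<^sub>M i\<in>{1..s}. item_space m d))" (is "?f \<in> ?B")
    for s x
  proof -
    let ?N = "capacity_space d \<Otimes>\<^sub>M (\<Pi>\<^sub>M i\<in>{1..s}. item_space m d)"
    let ?P = "{1..s} \<rightarrow>\<^sub>E Delta m"
    let ?ind = "\<lambda>y p. if y \<in> optimal m d s (fst p) (snd p) then 1 else 0 :: real"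
    have [measurable]: "Measurable.pred ?N (\<lambda>p. y \<in> optimal m d s (fst p) (snd p))" for y
      using measurable_optimal[where x = y] by (simp add: case_prod_beta)
    have "(\<lambda>p. ?ind x p / (\<Sum>y\<in>?P. ?ind y p)) \<in> borel_measurable ?N"
      by measurable
    moreover have "?f p = ?ind x p / (\<Sum>y\<in>?P. ?ind y p)" if "p \<in> space ?N" for p
    proof -
      have "optimal m d s (fst p) (snd p) \<noteq> {}"
        using that by (intro optimal_nonempty) (auto simp: space_pair_measure)
      moreover have "(\<Sum>y\<in>?P. ?ind y p) = card (?P \<inter> optimal m d s (fst p) (snd p))"
        by (subst sum.inter_restrict[symmetric]) (auto intro: finite_PiE finite_Delta)
      moreover have "?P \<inter> optimal m d s (fst p) (snd p) = optimal m d s (fst p) (snd p)"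
        by (auto simp: optimal_def feasible_def)
      ultimately show ?thesis
        by (simp add: case_prod_beta finite_optimal)
    qed
    ultimately show ?thesis
      by (rule measurable_cong[THEN iffD2, rotated])
  qed
  moreover have "?\<sigma> s c (\<lambda>i\<in>{1..s}. \<xi> (\<pi> i)) = map_pmf (\<lambda>x. \<lambda>i\<in>{1..s}. x (\<pi> i)) (?\<sigma> s c \<xi>)"
    if c: "c \<in> space (capacity_space d)" and p: "\<pi> permutes {1..s}" for s c \<xi> \<pi>
  proof -
    have "inj_on (\<lambda>x. \<lambda>i\<in>{1..s}. x (\<pi> i)) (optimal m d s c \<xi>)"
    proof (rule inj_onI)
      fix x y assume *: "x \<in> optimal m d s c \<xi>" "y \<in> optimal m d s c \<xi>"
        "(\<lambda>i\<in>{1..s}. x (\<pi> i)) = (\<lambda>i\<in>{1..s}. y (\<pi> i))"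
      have "x (\<pi> i) = y (\<pi> i)" if "i \<in> {1..s}" for i
        using fun_cong[OF *(3), of i] that by simp
      then have "x i = y i" if "i \<in> {1..s}" for i
        using that permutes_image[OF p] by (metis imageE)
      moreover have "x \<in> extensional {1..s}" "y \<in> extensional {1..s}"
        using * by (auto simp: optimal_def feasible_def PiE_def)
      ultimately show "x = y" by (rule extensionalityI[rotated 2])
    qed
    then show ?thesis
      unfolding optimal_permute[OF p]
      by (simp only: map_pmf_of_set_inj[OF _ optimal_nonempty[OF c] finite_optimal])
  qed
  moreover have "set_pmf (?\<sigma> s c \<xi>) \<subseteq> optimal m d s c \<xi>" if "c \<in> space (capacity_space d)" for s c \<xi>
    using set_pmf_of_set[OF optimal_nonempty[OF that] finite_optimal] by blast
  ultimately show "equivariant_solver m d ?\<sigma>"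
    unfolding equivariant_solver_def exact_solver_def by blast
qed

subsection \<open>Resolving policies\<close>

definition remaining_capacity ::
  "nat \<Rightarrow> nat \<Rightarrow> (nat \<Rightarrow> real) \<Rightarrow> (nat \<Rightarrow> item) \<Rightarrow> (nat \<Rightarrow> nat \<Rightarrow> real) \<Rightarrow> nat \<Rightarrow> nat \<Rightarrow> real" where
  "remaining_capacity m d b \<xi> xbar t =
     (\<lambda>k\<in>{1..d}. b k - (\<Sum>\<tau>=1..t. consumption m (\<xi> \<tau>) (xbar \<tau>) k))"

text \<open>
  The items \<open>t, \<dots>, T\<close> of the program solved at time \<open>t\<close>, renumbered \<open>1, \<dots>, T - t + 1\<close>: the
  observed item \<open>t\<close>, followed by the forecasts \<open>\<zeta> (t, \<tau>)\<close> made at time \<open>t\<close> for the items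
  \<open>\<tau> = t + 1, \<dots>, T\<close>.
\<close>

definition program_items ::
  "nat \<Rightarrow> (nat \<Rightarrow> item) \<Rightarrow> (nat \<times> nat \<Rightarrow> item) \<Rightarrow> nat \<Rightarrow> nat \<Rightarrow> item" where
  "program_items T \<xi> \<zeta> t =
     (\<lambda>i\<in>{1..T - t + 1}. if i = 1 then \<xi> t else \<zeta> (t, t + i - 1))"

text \<open>
  Joint distribution, over the solver's internal randomness only, of the decisions at times
  \<open>1, \<dots>, t\<close>, given the arrivals \<open>\<xi>\<close> and the forecasts \<open>\<zeta>\<close>.
\<close>

primrec decisions ::
  "nat \<Rightarrow> nat \<Rightarrow> nat \<Rightarrow> (nat \<Rightarrow> real) \<Rightarrow> solver \<Rightarrow> (nat \<Rightarrow> item) \<Rightarrow> (nat \<times> nat \<Rightarrow> item) \<Rightarrow>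
     nat \<Rightarrow> (nat \<Rightarrow> nat \<Rightarrow> real) pmf" where
  "decisions T m d b \<sigma> \<xi> \<zeta> 0 = return_pmf (\<lambda>_. undefined)"
| "decisions T m d b \<sigma> \<xi> \<zeta> (Suc t) =
     do {
       xbar \<leftarrow> decisions T m d b \<sigma> \<xi> \<zeta> t;
       x \<leftarrow> \<sigma> (T - Suc t + 1) (remaining_capacity m d b \<xi> xbar t) (program_items T \<xi> \<zeta> (Suc t));
       return_pmf (xbar(Suc t := x 1))
     }"

definition run_reward ::
  "nat \<Rightarrow> nat \<Rightarrow> nat \<Rightarrow> (nat \<Rightarrow> real) \<Rightarrow> solver \<Rightarrow> (nat \<Rightarrow> item) \<Rightarrow> (nat \<times> nat \<Rightarrow> item) \<Rightarrow> real" where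
  "run_reward T m d b \<sigma> \<xi> \<zeta> =
     measure_pmf.expectation (decisions T m d b \<sigma> \<xi> \<zeta> T)
       (\<lambda>xbar. \<Sum>t=1..T. reward m (\<xi> t) (xbar t))"

definition oso_reward ::
  "nat \<Rightarrow> nat \<Rightarrow> nat \<Rightarrow> (nat \<Rightarrow> real) \<Rightarrow> item measure \<Rightarrow> solver \<Rightarrow> real" where
  "oso_reward T m d b D \<sigma> =
     (\<integral>(\<xi>, \<zeta>). run_reward T m d b \<sigma> \<xi> \<zeta>
        \<partial>((\<Pi>\<^sub>M t\<in>{1..T}. D) \<Otimes>\<^sub>M (\<Pi>\<^sub>M p\<in>{(t, \<tau>). 1 \<le> t \<and> t < \<tau> \<and> \<tau> \<le> T}. D)))"

definition mean_item :: "nat \<Rightarrow> nat \<Rightarrow> item measure \<Rightarrow> item" where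
  "mean_item m d D =
     (\<lambda>j\<in>{1..m}. \<integral>\<xi>. fst \<xi> j \<partial>D, \<lambda>j\<in>{1..m}. \<lambda>k\<in>{1..d}. \<integral>\<xi>. snd \<xi> j k \<partial>D)"

definition ce_reward ::
  "nat \<Rightarrow> nat \<Rightarrow> nat \<Rightarrow> (nat \<Rightarrow> real) \<Rightarrow> item measure \<Rightarrow> solver \<Rightarrow> real" where
  "ce_reward T m d b D \<sigma> =
     (\<integral>\<xi>. run_reward T m d b \<sigma> \<xi> (\<lambda>_. mean_item m d D) \<partial>(\<Pi>\<^sub>M t\<in>{1..T}. D))"

end

theory Submission
  imports Defs
begin

text \<open>
  The mean of a distribution can describe an item that looks nothing like the items that arrive,
  and the certainty-equivalent heuristic can then be wrong in both directions at once. The instance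
  has two periods, one resource of capacity \<open>1\<close> and two supply nodes, which act as two
  alternative options for serving an item. With probability \<open>\<epsilon>\<close> the arriving item is a prize: its
  first option earns \<open>1\<close> and uses the whole capacity. Otherwise it is a decoy: its first option earns
  \<open>\<epsilon>\<^sup>2\<close> and uses \<open>\<epsilon>\<^sup>2\<close>, while its second option earns \<open>2 / (1 - \<epsilon>)\<close> but needs \<open>1 + \<epsilon>\<close>, so it can
  never be taken. In the mean item the second option shrinks to consumption \<open>(1 - \<epsilon>) (1 + \<epsilon>) =
  1 - \<epsilon>\<^sup>2\<close> with reward \<open>2\<close>: it seems affordable, and it exactly fits next to a decoy but not next to
  a prize.

  Expecting that phantom reward of \<open>2\<close>, the heuristic rejects a prize in the first period
  (\<open>ce_rejects_prize\<close>) and accepts a decoy there (\<open>ce_accepts_decoy\<close>), which leaves too little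
  capacity for a prize in the second period. So it collects a prize only if both items are prizes,
  and at most \<open>2 \<epsilon>\<^sup>2\<close> otherwise; its expected reward lies between \<open>\<epsilon>\<^sup>2\<close> and \<open>3 \<epsilon>\<^sup>2\<close>. The
  single-sample algorithm forecasts with a genuine item: if the first item is a prize and the sample
  is a decoy, it sees that the decoy has nothing to offer and takes the prize
  (\<open>oso_accepts_prize\<close>), which already earns \<open>\<epsilon> (1 - \<epsilon>)\<close> in expectation. The ratio is at least
  \<open>(1 - \<epsilon>) / (3 \<epsilon>)\<close>, which equals \<open>M\<close> for \<open>\<epsilon> = 1 / (3 M + 1)\<close>.

  Both expected rewards are Bochner integrals, which vanish by convention for a nonmeasurable
  integrand. Hence the bounds need \<open>measurable_run_reward\<close>: the reward of a run depends measurably on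
  arrivals and forecasts. It holds because a run is a finite tree of solver calls, each of whose
  probabilities is measurable in capacity and items.
\<close>

section \<open>Decisions of a resolving policy\<close>

lemma nonneg_consumption:
  assumes "\<xi> \<in> space (item_space m d)" "x \<in> Delta m" "k \<in> {1..d}"
  shows "0 \<le> consumption m \<xi> x k"
proof -
  have "0 \<le> snd \<xi> j k" if "j \<in> {1..m}" for j
    using assms(1,3) that
    by (auto simp: item_space_def space_pair_measure space_PiM space_restrict_space PiE_def Pi_def)
  moreover have "0 \<le> x j" if "j \<in> {1..m}" for j
    using assms(2) that by (force simp: Delta_def PiE_def Pi_def)
  ultimately show ?thesis
    unfolding consumption_def by (intro sum_nonneg mult_nonneg_nonneg)
qed

lemma space_capacity_space: "c \<in> space (capacity_space d) \<longleftrightarrow> c \<in> extensional {1..d} \<and> (\<forall>k\<in>{1..d}. 0 \<le> c k)"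
  by (auto simp: capacity_space_def space_PiM space_restrict_space PiE_def Pi_def)

lemma program_items_in_space:
  assumes "\<And>t. t \<in> {1..T} \<Longrightarrow> \<xi> t \<in> space (item_space m d)"
    and "\<And>t \<tau>. 1 \<le> t \<Longrightarrow> t < \<tau> \<Longrightarrow> \<tau> \<le> T \<Longrightarrow> \<zeta> (t, \<tau>) \<in> space (item_space m d)"
    and "t \<in> {1..T}"
  shows "program_items T \<xi> \<zeta> t \<in> space (\<Pi>\<^sub>M i\<in>{1..T - t + 1}. item_space m d)"
  using assms by (auto simp: program_items_def space_PiM)

lemma remaining_capacity_cong:
  assumes "\<And>\<tau>. \<tau> \<in> {1..t} \<Longrightarrow> x \<tau> = y \<tau>"
  shows "remaining_capacity m d b \<xi> x t = remaining_capacity m d b \<xi> y t"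
  unfolding remaining_capacity_def using assms
  by (intro ext restrict_ext) (auto intro!: arg_cong2[of _ _ _ _ "(-)"] sum.cong)

lemma remaining_capacity_Suc:
  assumes "k \<in> {1..d}"
  shows "remaining_capacity m d b \<xi> x (Suc t) k =
    remaining_capacity m d b \<xi> x t k - consumption m (\<xi> (Suc t)) (x (Suc t)) k"
  using assms by (simp add: remaining_capacity_def)

lemma feasible_first_item:
  assumes x: "x \<in> feasible m d s c \<xi>" and s: "1 \<le> s" and k: "k \<in> {1..d}"
    and \<xi>: "\<xi> \<in> space (\<Pi>\<^sub>M i\<in>{1..s}. item_space m d)"
  shows "consumption m (\<xi> 1) (x 1) k \<le> c k"
proof -
  have nonneg: "0 \<le> consumption m (\<xi> i) (x i) k" if "i \<in> {1..s}" for i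
    using that x k \<xi> by (intro nonneg_consumption) (auto simp: feasible_def space_PiM)
  have "consumption m (\<xi> 1) (x 1) k \<le> (\<Sum>i=1..s. consumption m (\<xi> i) (x i) k)"
    by (rule member_le_sum) (use s nonneg in auto)
  also have "\<dots> \<le> c k" using x k by (auto simp: feasible_def)
  finally show ?thesis .
qed

text \<open>
  The first component of a feasible solution leaves a nonnegative capacity, because the remaining
  items consume nonnegative amounts. So every program met during a run is feasible, the specification
  of the exact solver applies at each step, and the possible decisions stay in a finite set.
\<close>

lemma decisions_support:
  assumes \<sigma>: "exact_solver m d \<sigma>" and b: "b \<in> space (capacity_space d)"
    and \<xi>: "\<And>t. t \<in> {1..T} \<Longrightarrow> \<xi> t \<in> space (item_space m d)"
    and \<zeta>: "\<And>t \<tau>. 1 \<le> t \<Longrightarrow> t < \<tau> \<Longrightarrow> \<tau> \<le> T \<Longrightarrow> \<zeta> (t, \<tau>) \<in> space (item_space m d)"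
    and "t \<le> T" "xbar \<in> set_pmf (decisions T m d b \<sigma> \<xi> \<zeta> t)"
  shows "xbar \<in> {1..t} \<rightarrow>\<^sub>E Delta m \<and>
    remaining_capacity m d b \<xi> xbar t \<in> space (capacity_space d) \<and>
    (\<forall>\<tau>\<in>{1..t}. \<exists>x\<in>optimal m d (T - \<tau> + 1) (remaining_capacity m d b \<xi> xbar (\<tau> - 1))
        (program_items T \<xi> \<zeta> \<tau>). xbar \<tau> = x 1)"
  using assms(5,6)
proof (induction t arbitrary: xbar)
  case 0
  then show ?case
    using b by (auto simp: space_capacity_space remaining_capacity_def extensional_def)
next
  case (Suc t)
  let ?R = "remaining_capacity m d b \<xi>" and ?P = "program_items T \<xi> \<zeta> (Suc t)"
  obtain y x where y: "y \<in> set_pmf (decisions T m d b \<sigma> \<xi> \<zeta> t)"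
    and x: "x \<in> set_pmf (\<sigma> (T - Suc t + 1) (?R y t) ?P)" and xbar: "xbar = y(Suc t := x 1)"
    using Suc.prems(2) by auto
  note IH = Suc.IH[OF _ y]
  have P: "?P \<in> space (\<Pi>\<^sub>M i\<in>{1..T - Suc t + 1}. item_space m d)"
    by (rule program_items_in_space) (use \<xi> \<zeta> Suc.prems in auto)
  have R: "?R y t \<in> space (capacity_space d)" using IH Suc.prems by auto
  have opt: "x \<in> optimal m d (T - Suc t + 1) (?R y t) ?P"
    using \<sigma> R P x unfolding exact_solver_def by blast
  have same: "?R xbar \<tau> = ?R y \<tau>" if "\<tau> \<le> t" for \<tau>
    by (rule remaining_capacity_cong) (use that xbar in auto)
  have x1: "x 1 \<in> Delta m"
    using opt by (auto simp: optimal_def feasible_def)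
  have "xbar \<in> {1..Suc t} \<rightarrow>\<^sub>E Delta m"
    unfolding xbar using IH Suc.prems x1 by (auto simp: PiE_def Pi_def extensional_def)
  moreover have "0 \<le> ?R xbar (Suc t) k" if k: "k \<in> {1..d}" for k
  proof -
    have "consumption m (?P 1) (x 1) k \<le> ?R y t k"
      by (rule feasible_first_item[OF _ _ k P]) (use opt in \<open>auto simp: optimal_def\<close>)
    then show ?thesis
      unfolding remaining_capacity_Suc[OF k] same[OF order_refl]
      by (simp add: xbar program_items_def)
  qed
  then have "?R xbar (Suc t) \<in> space (capacity_space d)"
    by (auto simp: space_capacity_space remaining_capacity_def)
  moreover have "\<exists>x\<in>optimal m d (T - \<tau> + 1) (?R xbar (\<tau> - 1)) (program_items T \<xi> \<zeta> \<tau>). xbar \<tau> = x 1"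
    if \<tau>: "\<tau> \<in> {1..Suc t}" for \<tau>
  proof (cases "\<tau> = Suc t")
    case True
    then show ?thesis using opt same[of t] xbar by auto
  next
    case False
    then have "\<tau> \<in> {1..t}" using \<tau> by auto
    moreover have "?R xbar (\<tau> - 1) = ?R y (\<tau> - 1)" by (rule same) (use \<open>\<tau> \<in> {1..t}\<close> in auto)
    ultimately show ?thesis using IH Suc.prems xbar by auto
  qed
  ultimately show ?case by blast
qed

section \<open>Measurability of the reward of a run\<close>

lemma measurable_item_reward:
  assumes "j \<in> {1..m}"
  shows "(\<lambda>\<xi>. fst \<xi> j) \<in> borel_measurable (item_space m d)"
  using measurable_compose[OF measurable_fst measurable_component_singleton[OF assms]]
  by (simp add: item_space_def)

lemma measurable_item_consumption:
  assumes "j \<in> {1..m}" "k \<in> {1..d}"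
  shows "(\<lambda>\<xi>. snd \<xi> j k) \<in> borel_measurable (item_space m d)"
proof -
  have id: "(\<lambda>\<xi>. \<xi>) \<in> item_space m d \<rightarrow>\<^sub>M item_space m d" by simp
  show ?thesis
    using measurable_compose[OF measurable_compose[OF measurable_compose[OF
          id[unfolded item_space_def] measurable_snd]
          measurable_component_singleton[OF assms(1)]] measurable_component_singleton[OF assms(2)]]
    by (simp add: item_space_def measurable_restrict_space2_iff)
qed

lemma measurable_reward:
  assumes "X \<in> N \<rightarrow>\<^sub>M item_space m d"
  shows "(\<lambda>\<omega>. reward m (X \<omega>) x) \<in> borel_measurable N"
  unfolding reward_def
  by (intro borel_measurable_sum borel_measurable_times measurable_compose[OF assms]
      measurable_item_reward) auto

lemma measurable_consumption:
  assumes "X \<in> N \<rightarrow>\<^sub>M item_space m d" "k \<in> {1..d}"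
  shows "(\<lambda>\<omega>. consumption m (X \<omega>) x k) \<in> borel_measurable N"
  unfolding consumption_def
  by (intro borel_measurable_sum borel_measurable_times measurable_compose[OF assms(1)]
      measurable_item_consumption assms(2)) auto

lemma measurable_program_items:
  assumes X: "\<And>t. t \<in> {1..T} \<Longrightarrow> (\<lambda>\<omega>. X \<omega> t) \<in> N \<rightarrow>\<^sub>M item_space m d"
    and Z: "\<And>t \<tau>. 1 \<le> t \<Longrightarrow> t < \<tau> \<Longrightarrow> \<tau> \<le> T \<Longrightarrow> (\<lambda>\<omega>. Z \<omega> (t, \<tau>)) \<in> N \<rightarrow>\<^sub>M item_space m d"
    and "t \<in> {1..T}"
  shows "(\<lambda>\<omega>. program_items T (X \<omega>) (Z \<omega>) t) \<in> N \<rightarrow>\<^sub>M (\<Pi>\<^sub>M i\<in>{1..T - t + 1}. item_space m d)"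
  unfolding program_items_def
proof (rule measurable_restrict)
  fix i assume i: "i \<in> {1..T - t + 1}"
  show "(\<lambda>\<omega>. if i = 1 then X \<omega> t else Z \<omega> (t, t + i - 1)) \<in> N \<rightarrow>\<^sub>M item_space m d"
    using i assms by (cases "i = 1") auto
qed

text \<open>
  Arrivals and forecasts are arbitrary random variables on a common space, which covers sampled and
  deterministic forecasts alike. By induction, the probability of a decision history is a finite sum
  of products of solver probabilities.
\<close>

lemma measurable_pmf_decisions:
  assumes \<sigma>: "exact_solver m d \<sigma>" and b: "b \<in> space (capacity_space d)"
    and X: "\<And>t. t \<in> {1..T} \<Longrightarrow> (\<lambda>\<omega>. X \<omega> t) \<in> N \<rightarrow>\<^sub>M item_space m d"
    and Z: "\<And>t \<tau>. 1 \<le> t \<Longrightarrow> t < \<tau> \<Longrightarrow> \<tau> \<le> T \<Longrightarrow> (\<lambda>\<omega>. Z \<omega> (t, \<tau>)) \<in> N \<rightarrow>\<^sub>M item_space m d"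
    and "t \<le> T"
  shows "(\<lambda>\<omega>. pmf (decisions T m d b \<sigma> (X \<omega>) (Z \<omega>) t) y) \<in> borel_measurable N"
  using assms(5)
proof (induction t arbitrary: y)
  case 0
  then show ?case by simp
next
  case (Suc t)
  let ?s = "T - Suc t + 1"
  let ?D = "\<lambda>\<omega>. decisions T m d b \<sigma> (X \<omega>) (Z \<omega>)"
  let ?R = "\<lambda>\<omega> x. remaining_capacity m d b (X \<omega>) x t"
  let ?P = "\<lambda>\<omega>. program_items T (X \<omega>) (Z \<omega>) (Suc t)"
  let ?step = "\<lambda>x z. pmf (return_pmf (x(Suc t := z 1))) y :: real"
  \<comment> \<open>The solver is measurable only on nonnegative capacities. Truncating at \<open>0\<close> changes the
      capacity only on histories of probability zero.\<close>
  define C where "C \<omega> x = (\<lambda>k\<in>{1..d}. max 0 (?R \<omega> x k))" for \<omega> x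
  have C: "(\<lambda>\<omega>. C \<omega> x) \<in> N \<rightarrow>\<^sub>M capacity_space d" for x
    unfolding C_def capacity_space_def
  proof (rule measurable_restrict, rule measurable_restrict_space2)
    fix k assume k: "k \<in> {1..d}"
    have "(\<lambda>\<omega>. b k - (\<Sum>\<tau>=1..t. consumption m (X \<omega> \<tau>) (x \<tau>) k)) \<in> borel_measurable N"
      using Suc.prems k by (intro borel_measurable_diff borel_measurable_sum measurable_consumption)
        (auto intro: X)
    then have "(\<lambda>\<omega>. ?R \<omega> x k) \<in> borel_measurable N"
      using k by (simp add: remaining_capacity_def)
    then show "(\<lambda>\<omega>. max 0 (?R \<omega> x k)) \<in> borel_measurable N" by measurable
  qed auto
  have P: "?P \<in> N \<rightarrow>\<^sub>M (\<Pi>\<^sub>M i\<in>{1..?s}. item_space m d)"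
    by (rule measurable_program_items[where X = X and Z = Z]) (use X Z Suc.prems in auto)
  have \<sigma>meas: "(\<lambda>\<omega>. pmf (\<sigma> ?s (C \<omega> x) (?P \<omega>)) z) \<in> borel_measurable N" for x z
  proof -
    have "(\<lambda>(c, \<xi>). pmf (\<sigma> ?s c \<xi>) z)
        \<in> borel_measurable (capacity_space d \<Otimes>\<^sub>M (\<Pi>\<^sub>M i\<in>{1..?s}. item_space m d))"
      using \<sigma> unfolding exact_solver_def by blast
    from measurable_compose[OF measurable_Pair[OF C P] this] show ?thesis by simp
  qed
  have "pmf (?D \<omega> (Suc t)) y = (\<Sum>x\<in>{1..t} \<rightarrow>\<^sub>E Delta m.
      (\<Sum>z\<in>{1..?s} \<rightarrow>\<^sub>E Delta m. ?step x z * pmf (\<sigma> ?s (C \<omega> x) (?P \<omega>)) z) * pmf (?D \<omega> t) x)"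
    if \<omega>: "\<omega> \<in> space N" for \<omega>
  proof -
    have sp: "X \<omega> t \<in> space (item_space m d)" if "t \<in> {1..T}" for t
      using measurable_space[OF X[OF that] \<omega>] .
    have sp': "Z \<omega> (t, \<tau>) \<in> space (item_space m d)" if "1 \<le> t" "t < \<tau>" "\<tau> \<le> T" for t \<tau>
      using measurable_space[OF Z[OF that] \<omega>] .
    have supp: "x \<in> {1..t} \<rightarrow>\<^sub>E Delta m" "?R \<omega> x \<in> space (capacity_space d)"
      if "x \<in> set_pmf (?D \<omega> t)" for x
      using decisions_support[OF \<sigma> b sp sp' _ that] Suc.prems by auto
    have inner: "pmf (\<sigma> ?s (?R \<omega> x) (?P \<omega>) \<bind> (\<lambda>z. return_pmf (x(Suc t := z 1)))) y =
        (\<Sum>z\<in>{1..?s} \<rightarrow>\<^sub>E Delta m. ?step x z * pmf (\<sigma> ?s (C \<omega> x) (?P \<omega>)) z)"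
      if "x \<in> set_pmf (?D \<omega> t)" for x
    proof -
      have "C \<omega> x = ?R \<omega> x"
        using supp(2)[OF that]
        by (auto simp: C_def space_capacity_space extensional_def max_def fun_eq_iff antisym)
      moreover have "set_pmf (\<sigma> ?s (?R \<omega> x) (?P \<omega>)) \<subseteq> {1..?s} \<rightarrow>\<^sub>E Delta m"
        using \<sigma> supp(2)[OF that] measurable_space[OF P \<omega>]
        unfolding exact_solver_def optimal_def feasible_def by blast
      ultimately show ?thesis
        unfolding pmf_bind
        by (subst integral_measure_pmf_real[of "{1..?s} \<rightarrow>\<^sub>E Delta m"])
          (auto intro!: finite_PiE finite_Delta)
    qed
    show ?thesis
      unfolding decisions.simps pmf_bind[of "?D \<omega> t"]
      by (subst integral_measure_pmf_real[of "{1..t} \<rightarrow>\<^sub>E Delta m"])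
        (use supp(1) inner in \<open>auto intro!: finite_PiE finite_Delta sum.cong
            simp: pmf_eq_0_set_pmf simp del: atLeastAtMost_iff\<close>)
  qed
  moreover have "(\<lambda>\<omega>. \<Sum>x\<in>{1..t} \<rightarrow>\<^sub>E Delta m.
      (\<Sum>z\<in>{1..?s} \<rightarrow>\<^sub>E Delta m. ?step x z * pmf (\<sigma> ?s (C \<omega> x) (?P \<omega>)) z) * pmf (?D \<omega> t) x)
      \<in> borel_measurable N"
    using Suc.prems by (intro borel_measurable_sum borel_measurable_times \<sigma>meas Suc.IH) auto
  ultimately show ?case
    by (rule measurable_cong[THEN iffD2])
qed

lemma measurable_run_reward:
  assumes \<sigma>: "exact_solver m d \<sigma>" and b: "b \<in> space (capacity_space d)"
    and X: "\<And>t. t \<in> {1..T} \<Longrightarrow> (\<lambda>\<omega>. X \<omega> t) \<in> N \<rightarrow>\<^sub>M item_space m d"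
    and Z: "\<And>t \<tau>. 1 \<le> t \<Longrightarrow> t < \<tau> \<Longrightarrow> \<tau> \<le> T \<Longrightarrow> (\<lambda>\<omega>. Z \<omega> (t, \<tau>)) \<in> N \<rightarrow>\<^sub>M item_space m d"
  shows "(\<lambda>\<omega>. run_reward T m d b \<sigma> (X \<omega>) (Z \<omega>)) \<in> borel_measurable N"
proof -
  let ?D = "\<lambda>\<omega>. decisions T m d b \<sigma> (X \<omega>) (Z \<omega>) T"
  have "run_reward T m d b \<sigma> (X \<omega>) (Z \<omega>) = (\<Sum>x\<in>{1..T} \<rightarrow>\<^sub>E Delta m.
      (\<Sum>t=1..T. reward m (X \<omega> t) (x t)) * pmf (?D \<omega>) x)" if \<omega>: "\<omega> \<in> space N" for \<omega>
  proof -
    have "x \<in> {1..T} \<rightarrow>\<^sub>E Delta m" if "x \<in> set_pmf (?D \<omega>)" for x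
      using decisions_support[OF \<sigma> b measurable_space[OF X \<omega>] measurable_space[OF Z \<omega>] _ that]
      by auto
    then show ?thesis
      unfolding run_reward_def
      by (subst integral_measure_pmf_real[of "{1..T} \<rightarrow>\<^sub>E Delta m"])
        (auto intro!: finite_PiE finite_Delta)
  qed
  moreover have "(\<lambda>\<omega>. \<Sum>x\<in>{1..T} \<rightarrow>\<^sub>E Delta m.
      (\<Sum>t=1..T. reward m (X \<omega> t) (x t)) * pmf (?D \<omega>) x) \<in> borel_measurable N"
    by (intro borel_measurable_sum borel_measurable_times measurable_reward
        measurable_pmf_decisions[where X = X and Z = Z, OF \<sigma> b])
      (use X Z in auto)
  ultimately show ?thesis
    by (rule measurable_cong[THEN iffD2])
qed

section \<open>Items with two options and one resource\<close>

\<comment> \<open>Keeps the indices \<open>1\<close> and \<open>2\<close> of periods, options and resources in numeral form.\<close>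
declare One_nat_def [simp del]

definition two_option_item :: "real \<Rightarrow> real \<Rightarrow> real \<Rightarrow> real \<Rightarrow> item" where
  "two_option_item r r' a a' =
     (\<lambda>j\<in>{1..2}. if j = 1 then r else r', \<lambda>j\<in>{1..2}. \<lambda>k\<in>{1..1}. if j = 1 then a else a')"

lemma sum_upto_2: "(\<Sum>i=1..2::nat. f i) = f 1 + f 2" for f :: "nat \<Rightarrow> real"
  by (simp add: numeral_2_eq_2 One_nat_def)

lemma reward_two_option_item: "reward 2 (two_option_item r r' a a') x = r * x 1 + r' * x 2"
  by (simp add: reward_def two_option_item_def sum_upto_2)

lemma consumption_two_option_item:
  "consumption 2 (two_option_item r r' a a') x 1 = a * x 1 + a' * x 2"
  by (simp add: consumption_def two_option_item_def sum_upto_2)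

lemma two_option_item_in_space:
  assumes "0 \<le> a" "0 \<le> a'"
  shows "two_option_item r r' a a' \<in> space (item_space 2 1)"
  using assms
  by (auto simp: two_option_item_def item_space_def space_pair_measure space_PiM space_restrict_space)

definition choices :: "(real \<times> real) set" where
  "choices = {(0, 0), (1, 0), (0, 1)}"

lemma Delta_2_choices: "x \<in> Delta 2 \<Longrightarrow> (x 1, x 2) \<in> choices"
proof -
  assume x: "x \<in> Delta 2"
  then have "x 1 \<in> {0, 1}" "x 2 \<in> {0, 1}" "x 1 + x 2 \<le> 1"
    by (auto simp: Delta_def PiE_def Pi_def sum_upto_2)
  then show ?thesis by (auto simp: choices_def)
qed

definition choice_vector :: "real \<times> real \<Rightarrow> nat \<Rightarrow> real" where
  "choice_vector u = (\<lambda>j\<in>{1..2}. if j = 1 then fst u else snd u)"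

lemma choice_vector: "u \<in> choices \<Longrightarrow> choice_vector u \<in> Delta 2"
  "choice_vector u 1 = fst u" "choice_vector u 2 = snd u"
  by (auto simp: choice_vector_def Delta_def choices_def sum_upto_2 split: if_splits)

lemma optimal_one_item:
  assumes x: "x \<in> optimal 2 1 1 c I" and I: "I 1 = two_option_item r r' a a'"
  shows "(x 1 1, x 1 2) \<in> choices" "a * x 1 1 + a' * x 1 2 \<le> c 1"
    "(u, u') \<in> choices \<Longrightarrow> a * u + a' * u' \<le> c 1 \<Longrightarrow> r * u + r' * u' \<le> r * x 1 1 + r' * x 1 2"
proof -
  show "(x 1 1, x 1 2) \<in> choices"
    by (rule Delta_2_choices) (use x in \<open>auto simp: optimal_def feasible_def\<close>)
  show "a * x 1 1 + a' * x 1 2 \<le> c 1"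
    using x by (simp add: optimal_def feasible_def I consumption_two_option_item)
  assume u: "(u, u') \<in> choices" "a * u + a' * u' \<le> c 1"
  let ?y = "\<lambda>i\<in>{1..1}. choice_vector (u, u')"
  have "?y \<in> feasible 2 1 1 c I"
    using u choice_vector[of "(u, u')"]
    by (simp add: feasible_def I consumption_two_option_item)
  then have "(\<Sum>i=1..1. reward 2 (I i) (?y i)) \<le> (\<Sum>i=1..1. reward 2 (I i) (x i))"
    using x unfolding optimal_def by blast
  then show "r * u + r' * u' \<le> r * x 1 1 + r' * x 1 2"
    using choice_vector[of "(u, u')"]
    by (simp add: I reward_two_option_item)
qed

text \<open>
  Rewrites optimality into inequalities over the nine pairs of choices, so that each concrete
  program can be solved by cases.
\<close>

lemma optimal_two_items:
  assumes x: "x \<in> optimal 2 1 2 c I" and I: "I 1 = two_option_item r r' a a'" "I 2 = two_option_item s s' b b'"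
  shows "(x 1 1, x 1 2) \<in> choices" "(x 2 1, x 2 2) \<in> choices"
    "(a * x 1 1 + a' * x 1 2) + (b * x 2 1 + b' * x 2 2) \<le> c 1"
    "(u, u') \<in> choices \<Longrightarrow> (v, v') \<in> choices \<Longrightarrow> (a * u + a' * u') + (b * v + b' * v') \<le> c 1 \<Longrightarrow>
     (r * u + r' * u') + (s * v + s' * v') \<le> (r * x 1 1 + r' * x 1 2) + (s * x 2 1 + s' * x 2 2)"
proof -
  show "(x 1 1, x 1 2) \<in> choices" "(x 2 1, x 2 2) \<in> choices"
    by (rule Delta_2_choices; use x in \<open>force simp: optimal_def feasible_def\<close>)+
  show "(a * x 1 1 + a' * x 1 2) + (b * x 2 1 + b' * x 2 2) \<le> c 1"
    using x by (simp add: optimal_def feasible_def I sum_upto_2 consumption_two_option_item)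
  assume u: "(u, u') \<in> choices" "(v, v') \<in> choices" "(a * u + a' * u') + (b * v + b' * v') \<le> c 1"
  let ?y = "\<lambda>i\<in>{1..2}. choice_vector (if i = 1 then (u, u') else (v, v'))"
  have "?y \<in> feasible 2 1 2 c I"
    using u choice_vector[of "(u, u')"] choice_vector[of "(v, v')"]
    by (auto simp: feasible_def I sum_upto_2 consumption_two_option_item)
  then have "(\<Sum>i=1..2. reward 2 (I i) (?y i)) \<le> (\<Sum>i=1..2. reward 2 (I i) (x i))"
    using x unfolding optimal_def by blast
  then show "(r * u + r' * u') + (s * v + s' * v') \<le> (r * x 1 1 + r' * x 1 2) + (s * x 2 1 + s' * x 2 2)"
    using choice_vector[of "(u, u')"] choice_vector[of "(v, v')"]
    by (simp add: I sum_upto_2 reward_two_option_item)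
qed

section \<open>The instance and its optimal first decisions\<close>

definition prize :: item where "prize = two_option_item 1 0 1 0"

definition decoy :: "real \<Rightarrow> item" where
  "decoy \<epsilon> = two_option_item (\<epsilon>\<^sup>2) (2 / (1 - \<epsilon>)) (\<epsilon>\<^sup>2) (1 + \<epsilon>)"

text \<open>
  Arrivals are driven by coin flips, where heads means a prize. Transporting integrals back to the
  coin flips makes all bounds on runs hold pointwise.
\<close>

definition arrival :: "real \<Rightarrow> bool \<Rightarrow> item" where
  "arrival \<epsilon> v = (if v then prize else decoy \<epsilon>)"

definition arrival_law :: "real \<Rightarrow> item measure" where
  "arrival_law \<epsilon> = distr (measure_pmf (bernoulli_pmf \<epsilon>)) (item_space 2 1) (arrival \<epsilon>)"

definition unit_capacity :: "nat \<Rightarrow> real" where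
  "unit_capacity = (\<lambda>k\<in>{1..1}. 1)"

lemma unit_capacity_in_space: "unit_capacity \<in> space (capacity_space 1)"
  by (auto simp: space_capacity_space unit_capacity_def)

definition average_item :: "real \<Rightarrow> item" where
  "average_item \<epsilon> = two_option_item (\<epsilon> + (1 - \<epsilon>) * \<epsilon>\<^sup>2) 2 (\<epsilon> + (1 - \<epsilon>) * \<epsilon>\<^sup>2) (1 - \<epsilon>\<^sup>2)"

lemma arrival_in_space: "0 < \<epsilon> \<Longrightarrow> arrival \<epsilon> v \<in> space (item_space 2 1)"
  by (auto simp: arrival_def prize_def decoy_def intro!: two_option_item_in_space)

lemma average_item_in_space:
  assumes "0 < \<epsilon>" "\<epsilon> < 1"
  shows "average_item \<epsilon> \<in> space (item_space 2 1)"
  using assms by (auto simp: average_item_def power_le_one intro!: two_option_item_in_space)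

text \<open>
  A prize uses up the capacity, and both options of the mean item have positive consumption. So the
  prize excludes the phantom reward of \<open>2\<close> that the mean item promises.
\<close>

lemma ce_rejects_prize:
  assumes e: "0 < \<epsilon>" "\<epsilon> < 1"
    and x: "x \<in> optimal 2 1 2 c I" and I: "I 1 = prize" "I 2 = average_item \<epsilon>" and c: "c 1 = 1"
  shows "x 1 1 = 0"
proof (rule ccontr)
  assume "x 1 1 \<noteq> 0"
  note opt = optimal_two_items[OF x, of 1 0 1 0, unfolded I, OF prize_def average_item_def]
  have x1: "x 1 1 = 1" "x 1 2 = 0" using opt(1) \<open>x 1 1 \<noteq> 0\<close> by (auto simp: choices_def)
  have "0 < 1 - \<epsilon>\<^sup>2" using e by (simp add: power_less_one_iff)
  moreover have "0 < \<epsilon> + (1 - \<epsilon>) * \<epsilon>\<^sup>2" using e by (simp add: add_pos_nonneg)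
  ultimately have "x 2 1 = 0" "x 2 2 = 0"
    using opt(2,3) x1 c by (auto simp: choices_def)
  then show False
    using opt(4)[of 0 0 0 1] x1 c by (simp add: choices_def)
qed

text \<open>
  The first option of the decoy fits exactly next to the second option of the mean item, so it
  is worth its tiny reward. Without it, the program earns at most \<open>2\<close>.
\<close>

lemma ce_accepts_decoy:
  assumes e: "0 < \<epsilon>" "\<epsilon> < 1"
    and x: "x \<in> optimal 2 1 2 c I" and I: "I 1 = decoy \<epsilon>" "I 2 = average_item \<epsilon>" and c: "c 1 = 1"
  shows "x 1 1 = 1" "x 1 2 = 0"
proof -
  note opt = optimal_two_items[OF x, unfolded I, OF decoy_def average_item_def]
  let ?q = "\<epsilon> + (1 - \<epsilon>) * \<epsilon>\<^sup>2"
  have e2: "0 < \<epsilon>\<^sup>2" "\<epsilon>\<^sup>2 < 1" using e by (simp_all add: power_less_one_iff)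
  have le: "(1 - \<epsilon>) * \<epsilon>\<^sup>2 \<le> 1 - \<epsilon>" using mult_left_mono[of "\<epsilon>\<^sup>2" 1 "1 - \<epsilon>"] e e2 by simp
  then have q: "0 < ?q" "?q \<le> 1" using e le by (simp_all only: le_diff_eq add.commute) (simp add: add_pos_nonneg)
  have best: "\<epsilon>\<^sup>2 + 2 \<le> (\<epsilon>\<^sup>2 * x 1 1 + 2 / (1 - \<epsilon>) * x 1 2) + (?q * x 2 1 + 2 * x 2 2)"
    using opt(4)[of 1 0 0 1] c by (simp add: choices_def)
  then have less: "2 < (\<epsilon>\<^sup>2 * x 1 1 + 2 / (1 - \<epsilon>) * x 1 2) + (?q * x 2 1 + 2 * x 2 2)"
    using e2 by linarith
  show x12: "x 1 2 = 0"
  proof (rule ccontr)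
    assume "x 1 2 \<noteq> 0"
    then have "x 1 1 = 0" "x 1 2 = 1" using opt(1) by (auto simp: choices_def)
    moreover have "0 \<le> ?q * x 2 1 + (1 - \<epsilon>\<^sup>2) * x 2 2"
      using opt(2) q e2 by (auto simp: choices_def)
    ultimately show False using opt(3) c e by simp
  qed
  show "x 1 1 = 1"
    using less x12 opt(1,2) q by (auto simp: choices_def)
qed

text \<open>
  The second option of a sampled decoy exceeds the capacity, so forgoing the prize leaves at
  most the reward \<open>\<epsilon>\<^sup>2 < 1\<close>.
\<close>

lemma oso_accepts_prize:
  assumes e: "0 < \<epsilon>" "\<epsilon> < 1"
    and x: "x \<in> optimal 2 1 2 c I" and I: "I 1 = prize" "I 2 = decoy \<epsilon>" and c: "c 1 = 1"
  shows "x 1 1 = 1"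
proof (rule ccontr)
  assume "x 1 1 \<noteq> 1"
  note opt = optimal_two_items[OF x, of 1 0 1 0, unfolded I, OF prize_def decoy_def]
  have e2: "0 < \<epsilon>\<^sup>2" "\<epsilon>\<^sup>2 < 1" using e by (simp_all add: power_less_one_iff)
  have x1: "x 1 1 = 0" using opt(1) \<open>x 1 1 \<noteq> 1\<close> by (auto simp: choices_def)
  moreover have "x 2 2 = 0" using opt(2,3) x1 c e by (auto simp: choices_def)
  ultimately show False
    using opt(2) opt(4)[of 1 0 0 0] c e2 by (auto simp: choices_def)
qed

lemma arrival_measurable:
  "0 < \<epsilon> \<Longrightarrow> arrival \<epsilon> \<in> measure_pmf (bernoulli_pmf \<epsilon>) \<rightarrow>\<^sub>M item_space 2 1"
  by (simp add: Pi_iff arrival_in_space)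

lemma average_item_law:
  assumes "0 < \<epsilon>" "\<epsilon> < 1"
  shows "mean_item 2 1 (arrival_law \<epsilon>) = average_item \<epsilon>"
proof -
  note arrival = arrival_measurable[OF assms(1)]
  have r: "(\<integral>\<xi>. fst \<xi> j \<partial>arrival_law \<epsilon>) = \<epsilon> * fst prize j + (1 - \<epsilon>) * fst (decoy \<epsilon>) j"
    if "j \<in> {1..2}" for j
    using assms integral_distr[OF arrival measurable_item_reward[OF that]]
    by (simp add: arrival_law_def arrival_def)
  have a: "(\<integral>\<xi>. snd \<xi> j k \<partial>arrival_law \<epsilon>) = \<epsilon> * snd prize j k + (1 - \<epsilon>) * snd (decoy \<epsilon>) j k"
    if "j \<in> {1..2}" "k \<in> {1..1}" for j k
    using assms integral_distr[OF arrival measurable_item_consumption[OF that]]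
    by (simp add: arrival_law_def arrival_def)
  have "(1 - \<epsilon>) * (1 + \<epsilon>) = 1 - \<epsilon>\<^sup>2" by (simp add: power2_eq_square algebra_simps)
  moreover have "(2 - \<epsilon> * 2) / (1 - \<epsilon>) = 2" using assms by (simp add: divide_simps)
  ultimately show ?thesis
    using assms r a
    by (auto simp: mean_item_def average_item_def two_option_item_def prize_def decoy_def fun_eq_iff restrict_def)
qed

section \<open>Rewards of single runs\<close>

text \<open>
  The total rewards that a two-period run can reach with arrivals \<open>a\<close>, \<open>a'\<close> and forecast \<open>f\<close>, over all
  choices of optimal solutions in the two programs. The item lists and capacities of these programs
  are pinned down only where the programs depend on them.
\<close>

definition two_period_totals :: "item \<Rightarrow> item \<Rightarrow> item \<Rightarrow> real set" where
  "two_period_totals a a' f = {reward 2 a (x 1) + reward 2 a' (y 1) | x y I J c c'.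
     x \<in> optimal 2 1 2 c I \<and> I 1 = a \<and> I 2 = f \<and> c 1 = 1 \<and>
     y \<in> optimal 2 1 1 c' J \<and> J 1 = a' \<and> c' 1 = 1 - consumption 2 a (x 1) 1}"

lemma run_reward_two_periods_bounds:
  assumes \<sigma>: "exact_solver 2 1 \<sigma>"
    and sp: "\<xi> 1 \<in> space (item_space 2 1)" "\<xi> 2 \<in> space (item_space 2 1)"
      "\<zeta> (1, 2) \<in> space (item_space 2 1)"
    and bounds: "two_period_totals (\<xi> 1) (\<xi> 2) (\<zeta> (1, 2)) \<subseteq> {lo..hi}"
  shows "run_reward 2 2 1 unit_capacity \<sigma> \<xi> \<zeta> \<in> {lo..hi}"
proof -
  let ?D = "decisions 2 2 1 unit_capacity \<sigma> \<xi> \<zeta> 2"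
  let ?f = "\<lambda>xbar. \<Sum>t=1..2. reward 2 (\<xi> t) (xbar t)"
  let ?R = "remaining_capacity 2 1 unit_capacity \<xi>" and ?P = "program_items 2 \<xi> \<zeta>"
  have \<zeta>: "\<zeta> (t, \<tau>) \<in> space (item_space 2 1)" if "1 \<le> t" "t < \<tau>" "\<tau> \<le> 2" for t \<tau>
  proof -
    have "t = 1 \<and> \<tau> = 2" using that by auto
    then show ?thesis using sp(3) by simp
  qed
  have \<xi>: "\<xi> t \<in> space (item_space 2 1)" if "t \<in> {1..2}" for t
  proof -
    have "t = 1 \<or> t = 2" using that by auto
    then show ?thesis using sp by auto
  qed
  have supp: "xbar \<in> {1..2} \<rightarrow>\<^sub>E Delta 2"
    "\<And>\<tau>. \<tau> \<in> {1..2} \<Longrightarrow> \<exists>x\<in>optimal 2 1 (2 - \<tau> + 1) (?R xbar (\<tau> - 1)) (?P \<tau>). xbar \<tau> = x 1"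
    if "xbar \<in> set_pmf ?D" for xbar
    using decisions_support[OF \<sigma> unit_capacity_in_space \<xi> \<zeta> order_refl that] by auto
  have fin: "finite (set_pmf ?D)"
    by (rule finite_subset[of _ "{1..2} \<rightarrow>\<^sub>E Delta 2"])
      (use supp(1) in \<open>auto intro: finite_PiE finite_Delta\<close>)
  have f: "lo \<le> ?f xbar \<and> ?f xbar \<le> hi" if xbar: "xbar \<in> set_pmf ?D" for xbar
  proof -
    obtain x where x: "x \<in> optimal 2 1 2 (?R xbar 0) (?P 1)" "xbar 1 = x 1"
      using supp(2)[OF xbar, of 1] by auto
    obtain y where y: "y \<in> optimal 2 1 1 (?R xbar 1) (?P 2)" "xbar 2 = y 1"
      using supp(2)[OF xbar, of 2] by (auto simp: One_nat_def)
    have "?f xbar \<in> two_period_totals (\<xi> 1) (\<xi> 2) (\<zeta> (1, 2))"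
      unfolding two_period_totals_def
    proof (intro CollectI exI conjI)
      show "?f xbar = reward 2 (\<xi> 1) (x 1) + reward 2 (\<xi> 2) (y 1)"
        using x(2) y(2) by (simp add: sum_upto_2)
      show "x \<in> optimal 2 1 2 (?R xbar 0) (?P 1)" "y \<in> optimal 2 1 1 (?R xbar 1) (?P 2)"
        by (rule x(1) y(1))+
    qed (use x(2) in \<open>simp_all add: program_items_def remaining_capacity_def unit_capacity_def\<close>)
    then show ?thesis using bounds by auto
  qed
  have int: "integrable ?D ?f" by (rule integrable_measure_pmf_finite[OF fin])
  have "(\<integral>x. lo \<partial>?D) \<le> (\<integral>x. ?f x \<partial>?D)"
    by (rule integral_mono_AE) (use int f in \<open>auto simp: AE_measure_pmf_iff\<close>)
  then have "lo \<le> run_reward 2 2 1 unit_capacity \<sigma> \<xi> \<zeta>" by (simp add: run_reward_def)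
  moreover have "(\<integral>x. ?f x \<partial>?D) \<le> (\<integral>x. hi \<partial>?D)"
    by (rule integral_mono_AE) (use int f in \<open>auto simp: AE_measure_pmf_iff\<close>)
  then have "run_reward 2 2 1 unit_capacity \<sigma> \<xi> \<zeta> \<le> hi" by (simp add: run_reward_def)
  ultimately show ?thesis by simp
qed

text \<open>
  After a rejected prize the full capacity remains, and the second item earns \<open>1\<close> or \<open>\<epsilon>\<^sup>2\<close>. After an
  accepted decoy the capacity \<open>1 - \<epsilon>\<^sup>2\<close> excludes a prize, and another decoy adds at most \<open>\<epsilon>\<^sup>2\<close>.
\<close>

lemma ce_totals:
  assumes e: "0 < \<epsilon>" "\<epsilon> < 1"
  shows "two_period_totals (arrival \<epsilon> v) (arrival \<epsilon> w) (average_item \<epsilon>)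
    \<subseteq> {\<epsilon>\<^sup>2..2 * \<epsilon>\<^sup>2 + of_bool (v \<and> w)}"
proof -
  have e2: "0 < \<epsilon>\<^sup>2" "\<epsilon>\<^sup>2 < 1" using e by (simp_all add: power_less_one_iff)
  have "\<epsilon>\<^sup>2 \<le> reward 2 (arrival \<epsilon> v) (x 1) + reward 2 (arrival \<epsilon> w) (y 1) \<and>
      reward 2 (arrival \<epsilon> v) (x 1) + reward 2 (arrival \<epsilon> w) (y 1) \<le> 2 * \<epsilon>\<^sup>2 + of_bool (v \<and> w)"
    if x: "x \<in> optimal 2 1 2 c I" "I 1 = arrival \<epsilon> v" "I 2 = average_item \<epsilon>" "c 1 = 1"
      and y: "y \<in> optimal 2 1 1 c' J" "J 1 = arrival \<epsilon> w" "c' 1 = 1 - consumption 2 (arrival \<epsilon> v) (x 1) 1"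
    for x y I J c c'
  proof -
    note prize_opt = optimal_one_item[OF y(1), of 1 0 1 0, folded prize_def]
    note decoy_opt = optimal_one_item[OF y(1), of "\<epsilon>\<^sup>2" "2 / (1 - \<epsilon>)" "\<epsilon>\<^sup>2" "1 + \<epsilon>", folded decoy_def]
    note [simp] = prize_def decoy_def reward_two_option_item consumption_two_option_item
    show ?thesis
    proof (cases v)
      case True
      then have I1: "I 1 = prize" using x(2) by (simp add: arrival_def)
      then have "x 1 1 = 0" by (rule ce_rejects_prize[OF e x(1) _ x(3,4)])
      then have c': "c' 1 = 1" and r: "reward 2 (arrival \<epsilon> v) (x 1) = 0"
        using y(3) I1 x(2) by auto
      show ?thesis
      proof (cases w)
        case True
        then have J: "J 1 = prize" using y(2) by (simp add: arrival_def)
        then show ?thesis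
          using prize_opt(1) prize_opt(3)[of 1 0] r c' e2 \<open>v\<close> True y(2) by (auto simp: choices_def)
      next
        case False
        then have J: "J 1 = decoy \<epsilon>" using y(2) by (simp add: arrival_def)
        then have "y 1 2 = 0" using decoy_opt(1,2) c' e by (auto simp: choices_def)
        then show ?thesis
          using decoy_opt(1) decoy_opt(3)[of 1 0] J r c' e2 False y(2) by (auto simp: choices_def)
      qed
    next
      case False
      then have I1: "I 1 = decoy \<epsilon>" using x(2) by (simp add: arrival_def)
      then have "x 1 1 = 1" "x 1 2 = 0" using ce_accepts_decoy[OF e x(1) _ x(3,4)] by auto
      then have c': "c' 1 = 1 - \<epsilon>\<^sup>2" and r: "reward 2 (arrival \<epsilon> v) (x 1) = \<epsilon>\<^sup>2"
        using y(3) I1 x(2) by auto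
      show ?thesis
      proof (cases w)
        case True
        then have J: "J 1 = prize" using y(2) by (simp add: arrival_def)
        then have "y 1 1 = 0" using prize_opt(1,2) c' e2 by (auto simp: choices_def)
        then show ?thesis
          using J r e2 y(2) by auto
      next
        case w: False
        then have J: "J 1 = decoy \<epsilon>" using y(2) by (simp add: arrival_def)
        have "y 1 2 = 0"
        proof (rule ccontr)
          assume "y 1 2 \<noteq> 0"
          then have "y 1 1 = 0" "y 1 2 = 1" using decoy_opt(1) J by (auto simp: choices_def)
          then show False using decoy_opt(2) J c' e(1) e2(1) by (simp del: zero_less_power2)
        qed
        then show ?thesis
          using decoy_opt(1) J r e2 y(2) by (auto simp: choices_def)
      qed
    qed
  qed
  then show ?thesis unfolding two_period_totals_def by auto
qed

text \<open>
  The upper bound is crude: no option earns more than \<open>2 / (1 - \<epsilon>)\<close>. It only serves to make the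
  reward integrable.
\<close>

lemma oso_totals:
  assumes e: "0 < \<epsilon>" "\<epsilon> < 1"
  shows "two_period_totals (arrival \<epsilon> v) (arrival \<epsilon> v') (arrival \<epsilon> w)
    \<subseteq> {of_bool (v \<and> \<not> w)..4 / (1 - \<epsilon>)}"
proof -
  have e2: "0 < \<epsilon>\<^sup>2" "\<epsilon>\<^sup>2 < 1" using e by (simp_all add: power_less_one_iff)
  have L: "2 \<le> 2 / (1 - \<epsilon>)" using e by (simp add: field_simps)
  have r: "0 \<le> reward 2 (arrival \<epsilon> u) z" "reward 2 (arrival \<epsilon> u) z \<le> 2 / (1 - \<epsilon>)"
    if "(z 1, z 2) \<in> choices" for u z
    using that e e2 L
    by (auto simp: arrival_def prize_def decoy_def reward_two_option_item choices_def)
  have "of_bool (v \<and> \<not> w) \<le> reward 2 (arrival \<epsilon> v) (x 1) + reward 2 (arrival \<epsilon> v') (y 1) \<and>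
      reward 2 (arrival \<epsilon> v) (x 1) + reward 2 (arrival \<epsilon> v') (y 1) \<le> 4 / (1 - \<epsilon>)"
    if x: "x \<in> optimal 2 1 2 c I" "I 1 = arrival \<epsilon> v" "I 2 = arrival \<epsilon> w" "c 1 = 1"
      and y: "y \<in> optimal 2 1 1 c' J" "J 1 = arrival \<epsilon> v'" "c' 1 = 1 - consumption 2 (arrival \<epsilon> v) (x 1) 1"
    for x y I J c c'
  proof -
    have "x 1 \<in> Delta 2" "y 1 \<in> Delta 2"
      using x(1) y(1) by (auto simp: optimal_def feasible_def)
    then have ch: "(x 1 1, x 1 2) \<in> choices" "(y 1 1, y 1 2) \<in> choices"
      by (auto intro: Delta_2_choices)
    have "1 \<le> reward 2 (arrival \<epsilon> v) (x 1)" if "v" "\<not> w"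
      using oso_accepts_prize[OF e x(1) _ _ x(4)] x(2,3) that
      by (simp add: arrival_def prize_def reward_two_option_item)
    then show ?thesis
      using r[where z = "x 1" and u = v] r[where z = "y 1" and u = v'] ch by auto
  qed
  then show ?thesis unfolding two_period_totals_def by auto
qed

section \<open>Expected rewards\<close>

lemma prob_space_arrival_law: "0 < \<epsilon> \<Longrightarrow> prob_space (arrival_law \<epsilon>)"
  unfolding arrival_law_def by (intro measure_pmf.prob_space_distr arrival_measurable)

lemma sets_arrival_law: "sets (arrival_law \<epsilon>) = sets (item_space 2 1)"
  by (simp add: arrival_law_def)

abbreviation coin_flips :: "real \<Rightarrow> 'i set \<Rightarrow> ('i \<Rightarrow> bool) measure" where
  "coin_flips \<epsilon> I \<equiv> \<Pi>\<^sub>M i\<in>I. measure_pmf (bernoulli_pmf \<epsilon>)"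

lemma compose_arrival_measurable:
  assumes "0 < \<epsilon>"
  shows "compose I (arrival \<epsilon>) \<in> coin_flips \<epsilon> I \<rightarrow>\<^sub>M (\<Pi>\<^sub>M i\<in>I. item_space 2 1)"
  unfolding compose_def
  by (intro measurable_restrict measurable_compose[OF _ arrival_measurable[OF assms]]
      measurable_component_singleton)

lemma PiM_arrival_law:
  assumes "0 < \<epsilon>" "finite I"
  shows "(\<Pi>\<^sub>M i\<in>I. arrival_law \<epsilon>) =
    distr (coin_flips \<epsilon> I) (\<Pi>\<^sub>M i\<in>I. item_space 2 1) (compose I (arrival \<epsilon>))"
proof -
  have "distr (coin_flips \<epsilon> I) (\<Pi>\<^sub>M i\<in>I. arrival_law \<epsilon>) (compose I (arrival \<epsilon>)) =
      (\<Pi>\<^sub>M i\<in>I. distr (measure_pmf (bernoulli_pmf \<epsilon>)) (arrival_law \<epsilon>) (arrival \<epsilon>))"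
    using assms arrival_measurable[OF assms(1)]
    by (intro distr_PiM_finite_prob_space')
      (auto simp: prob_space_arrival_law measure_pmf.prob_space_axioms
        measurable_cong_sets[OF refl sets_arrival_law])
  also have "distr (measure_pmf (bernoulli_pmf \<epsilon>)) (arrival_law \<epsilon>) (arrival \<epsilon>) = arrival_law \<epsilon>"
    unfolding arrival_law_def by (rule distr_cong) auto
  also have "distr (coin_flips \<epsilon> I) (\<Pi>\<^sub>M i\<in>I. arrival_law \<epsilon>) (compose I (arrival \<epsilon>)) =
      distr (coin_flips \<epsilon> I) (\<Pi>\<^sub>M i\<in>I. item_space 2 1) (compose I (arrival \<epsilon>))"
    by (rule distr_cong) (simp_all add: sets_arrival_law cong: sets_PiM_cong)
  finally show ?thesis ..
qed

lemma prob_space_coin_flips: "prob_space (coin_flips \<epsilon> I)"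
  by (intro prob_space_PiM measure_pmf.prob_space_axioms)

lemma prob_coin_flips:
  assumes "finite I"
  shows "measure (coin_flips \<epsilon> I) (\<Pi>\<^sub>E i\<in>I. A i) = (\<Prod>i\<in>I. measure (measure_pmf (bernoulli_pmf \<epsilon>)) (A i))"
proof -
  interpret finite_product_prob_space "\<lambda>_. measure_pmf (bernoulli_pmf \<epsilon>)" I
    by unfold_locales (use assms in auto)
  show ?thesis by (rule prob_times) auto
qed

lemma ce_reward_bounds:
  assumes e: "0 < \<epsilon>" "\<epsilon> < 1" and \<rho>: "exact_solver 2 1 \<rho>"
  shows "\<epsilon>\<^sup>2 \<le> ce_reward 2 2 1 unit_capacity (arrival_law \<epsilon>) \<rho>"
    "ce_reward 2 2 1 unit_capacity (arrival_law \<epsilon>) \<rho> \<le> 3 * \<epsilon>\<^sup>2"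
proof -
  let ?N = "\<Pi>\<^sub>M t\<in>{1..2::nat}. item_space 2 1" and ?P = "coin_flips \<epsilon> {1..2::nat}"
  let ?run = "\<lambda>\<xi>. run_reward 2 2 1 unit_capacity \<rho> \<xi> (\<lambda>_. average_item \<epsilon>)"
  let ?f = "\<lambda>v. ?run (compose {1..2} (arrival \<epsilon>) v)"
  define S where "S = (\<Pi>\<^sub>E t\<in>{1..2::nat}. {True})"
  interpret P: prob_space ?P by (rule prob_space_coin_flips)
  have run: "?run \<in> borel_measurable ?N"
    by (rule measurable_run_reward[OF \<rho> unit_capacity_in_space])
      (simp_all add: average_item_in_space[OF e])
  have f: "?f \<in> borel_measurable ?P"
    by (rule measurable_compose[OF compose_arrival_measurable[OF e(1)] run])
  have bounds: "\<epsilon>\<^sup>2 \<le> ?f v" "?f v \<le> 2 * \<epsilon>\<^sup>2 + of_bool (v 1 \<and> v 2)" for v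
  proof -
    have "?f v \<in> {\<epsilon>\<^sup>2..2 * \<epsilon>\<^sup>2 + of_bool (v 1 \<and> v 2)}"
      by (rule run_reward_two_periods_bounds[OF \<rho>])
        (simp_all add: compose_def arrival_in_space average_item_in_space ce_totals e)
    then show "\<epsilon>\<^sup>2 \<le> ?f v" "?f v \<le> 2 * \<epsilon>\<^sup>2 + of_bool (v 1 \<and> v 2)" by simp_all
  qed
  have "?f v \<le> 2 * \<epsilon>\<^sup>2 + 1" for v
    by (rule order_trans[OF bounds(2)]) simp
  moreover have "0 \<le> ?f v" for v
    by (rule order_trans[OF _ bounds(1)]) simp
  ultimately have int: "integrable ?P ?f"
    by (intro P.integrable_const_bound[where B = "2 * \<epsilon>\<^sup>2 + 1"] f) auto
  have ce: "ce_reward 2 2 1 unit_capacity (arrival_law \<epsilon>) \<rho> = (\<integral>v. ?f v \<partial>?P)"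
    unfolding ce_reward_def average_item_law[OF e] PiM_arrival_law[OF e(1) finite_atLeastAtMost]
    by (rule integral_distr[OF compose_arrival_measurable[OF e(1)] run])
  have "(\<integral>v. \<epsilon>\<^sup>2 \<partial>?P) \<le> (\<integral>v. ?f v \<partial>?P)"
    by (rule integral_mono[OF _ int bounds(1)]) simp
  then show "\<epsilon>\<^sup>2 \<le> ce_reward 2 2 1 unit_capacity (arrival_law \<epsilon>) \<rho>"
    by (simp add: ce P.prob_space)
  have S: "S \<in> sets ?P" unfolding S_def by (rule sets_PiM_I_finite) auto
  have "(\<integral>v. ?f v \<partial>?P) \<le> (\<integral>v. 2 * \<epsilon>\<^sup>2 + indicator S v \<partial>?P)"
  proof (rule integral_mono[OF int])
    show "integrable ?P (\<lambda>v. 2 * \<epsilon>\<^sup>2 + indicator S v :: real)"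
      using S by (intro Bochner_Integration.integrable_add integrable_real_indicator) (simp_all add: P.emeasure_eq_measure)
    fix v assume v: "v \<in> space ?P"
    have "v \<in> S" if "v 1 \<and> v 2"
      unfolding S_def
    proof (rule PiE_I)
      show "v t \<in> {True}" if "t \<in> {1..2}" for t
      proof -
        have "t = 1 \<or> t = 2" using that by auto
        then show ?thesis using \<open>v 1 \<and> v 2\<close> by auto
      qed
    qed (use v in \<open>simp add: space_PiM PiE_iff extensional_def\<close>)
    then have "of_bool (v 1 \<and> v 2) \<le> (indicator S v :: real)"
      by (simp add: indicator_def)
    with bounds(2)[of v] show "?f v \<le> 2 * \<epsilon>\<^sup>2 + indicator S v" by linarith
  qed
  also have "\<dots> = 2 * \<epsilon>\<^sup>2 + measure ?P S"
  proof (subst Bochner_Integration.integral_add)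
    show "integrable ?P (indicator S :: _ \<Rightarrow> real)"
      using S by (intro integrable_real_indicator) (simp_all add: P.emeasure_eq_measure)
  qed (use S in \<open>simp_all add: P.prob_space\<close>)
  also have "measure ?P S = \<epsilon>\<^sup>2"
    using e unfolding S_def by (subst prob_coin_flips) (simp_all add: measure_pmf_single)
  finally show "ce_reward 2 2 1 unit_capacity (arrival_law \<epsilon>) \<rho> \<le> 3 * \<epsilon>\<^sup>2"
    by (simp add: ce)
qed

lemma oso_reward_bound:
  assumes e: "0 < \<epsilon>" "\<epsilon> < 1" and \<sigma>: "exact_solver 2 1 \<sigma>"
  shows "\<epsilon> * (1 - \<epsilon>) \<le> oso_reward 2 2 1 unit_capacity (arrival_law \<epsilon>) \<sigma>"
proof -
  define F :: "(nat \<times> nat) set" where "F = {(t, \<tau>). 1 \<le> t \<and> t < \<tau> \<and> \<tau> \<le> 2}"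
  have F: "F = {(1, 2)}" unfolding F_def by auto
  let ?I = "{1..2::nat}"
  let ?N = "(\<Pi>\<^sub>M t\<in>?I. item_space 2 1) \<Otimes>\<^sub>M (\<Pi>\<^sub>M p\<in>F. item_space 2 1)"
  let ?P = "coin_flips \<epsilon> ?I \<Otimes>\<^sub>M coin_flips \<epsilon> F"
  let ?g = "\<lambda>(v, w). (compose ?I (arrival \<epsilon>) v, compose F (arrival \<epsilon>) w)"
  let ?run = "\<lambda>(\<xi>, \<zeta>). run_reward 2 2 1 unit_capacity \<sigma> \<xi> \<zeta>"
  let ?f = "\<lambda>p. ?run (?g p)"
  let ?S = "(\<Pi>\<^sub>E t\<in>?I. if t = 1 then {True} else UNIV) \<times> (\<Pi>\<^sub>E p\<in>F. {False})"
  interpret P1: prob_space "coin_flips \<epsilon> ?I" by (rule prob_space_coin_flips)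
  interpret P2: prob_space "coin_flips \<epsilon> F" by (rule prob_space_coin_flips)
  interpret P: pair_prob_space "coin_flips \<epsilon> ?I" "coin_flips \<epsilon> F" ..
  have g: "?g \<in> ?P \<rightarrow>\<^sub>M ?N"
    unfolding case_prod_beta
    by (intro measurable_Pair measurable_compose[OF measurable_fst compose_arrival_measurable]
        measurable_compose[OF measurable_snd compose_arrival_measurable] e)
  have run: "?run \<in> borel_measurable ?N"
    unfolding case_prod_beta
  proof (rule measurable_run_reward[OF \<sigma> unit_capacity_in_space])
    show "(\<lambda>\<omega>. fst \<omega> t) \<in> ?N \<rightarrow>\<^sub>M item_space 2 1" if "t \<in> ?I" for t
      using that by measurable
    show "(\<lambda>\<omega>. snd \<omega> (t, \<tau>)) \<in> ?N \<rightarrow>\<^sub>M item_space 2 1" if "1 \<le> t" "t < \<tau>" "\<tau> \<le> 2" for t \<tau>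
    proof -
      have "(t, \<tau>) \<in> F" using that by (simp add: F_def)
      then show ?thesis by measurable
    qed
  qed
  have f: "?f \<in> borel_measurable ?P" by (rule measurable_compose[OF g run])
  have law: "(\<Pi>\<^sub>M t\<in>?I. arrival_law \<epsilon>) \<Otimes>\<^sub>M (\<Pi>\<^sub>M p\<in>F. arrival_law \<epsilon>) = distr ?P ?N ?g"
  proof -
    have "finite F" by (simp add: F)
    moreover have "sigma_finite_measure (\<Pi>\<^sub>M p\<in>F. arrival_law \<epsilon>)"
      by (intro prob_space_imp_sigma_finite prob_space_PiM prob_space_arrival_law e)
    ultimately show ?thesis
      using e by (simp add: PiM_arrival_law pair_measure_distr compose_arrival_measurable)
  qed
  have oso: "oso_reward 2 2 1 unit_capacity (arrival_law \<epsilon>) \<sigma> = (\<integral>p. ?f p \<partial>?P)"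
    unfolding oso_reward_def F_def[symmetric] law by (rule integral_distr[OF g run])
  have bounds: "of_bool (fst p 1 \<and> \<not> snd p (1, 2)) \<le> ?f p" "?f p \<le> 4 / (1 - \<epsilon>)" for p
  proof -
    have "?f p \<in> {of_bool (fst p 1 \<and> \<not> snd p (1, 2))..4 / (1 - \<epsilon>)}"
      unfolding case_prod_beta fst_conv snd_conv
      by (rule run_reward_two_periods_bounds[OF \<sigma>])
        (simp_all add: compose_def F arrival_in_space oso_totals e)
    then show "of_bool (fst p 1 \<and> \<not> snd p (1, 2)) \<le> ?f p" "?f p \<le> 4 / (1 - \<epsilon>)"
      by simp_all
  qed
  have "0 \<le> ?f p" for p
    by (rule order_trans[OF _ bounds(1)]) simp
  then have int: "integrable ?P ?f"
    using bounds(2) by (intro P.integrable_const_bound[where B = "4 / (1 - \<epsilon>)"] f) auto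
  have S1: "(\<Pi>\<^sub>E t\<in>?I. if t = 1 then {True} else UNIV) \<in> sets (coin_flips \<epsilon> ?I)"
    by (rule sets_PiM_I_finite) auto
  have S2: "(\<Pi>\<^sub>E p\<in>F. {False}) \<in> sets (coin_flips \<epsilon> F)"
    by (rule sets_PiM_I_finite) (auto simp: F)
  have "emeasure ?P ?S = emeasure (coin_flips \<epsilon> ?I) (\<Pi>\<^sub>E t\<in>?I. if t = 1 then {True} else UNIV) *
      emeasure (coin_flips \<epsilon> F) (\<Pi>\<^sub>E p\<in>F. {False})"
    by (rule P2.emeasure_pair_measure_Times[OF S1 S2])
  then have "measure ?P ?S = measure (coin_flips \<epsilon> ?I) (\<Pi>\<^sub>E t\<in>?I. if t = 1 then {True} else UNIV) *
      measure (coin_flips \<epsilon> F) (\<Pi>\<^sub>E p\<in>F. {False})"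
    by (simp add: measure_def enn2real_mult)
  also have "\<dots> = \<epsilon> * (1 - \<epsilon>)"
  proof -
    have I: "?I = {1, 2}" by auto
    show ?thesis
      using e by (subst (1 2) prob_coin_flips) (simp_all add: F I measure_pmf_single)
  qed
  finally have "\<epsilon> * (1 - \<epsilon>) = (\<integral>p. indicator ?S p \<partial>?P)"
    using S1 S2 by simp
  also have "\<dots> \<le> (\<integral>p. ?f p \<partial>?P)"
  proof (rule integral_mono[OF _ int])
    show "integrable ?P (indicator ?S :: _ \<Rightarrow> real)"
      using S1 S2 by (intro integrable_real_indicator) (simp_all add: P.emeasure_eq_measure)
    show "indicator ?S p \<le> ?f p" for p
    proof (cases "p \<in> ?S")
      case True
      then have "fst p 1 = True" "snd p (1, 2) = False"
        by (auto simp: F mem_Times_iff PiE_iff dest: bspec[of _ _ 1])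
      then show ?thesis using bounds(1)[of p] True by (simp add: indicator_def)
    next
      case False
      then show ?thesis using \<open>0 \<le> ?f p\<close> by (simp add: indicator_def)
    qed
  qed
  finally show ?thesis by (simp add: oso)
qed

lemma online_instance_arrival_law:
  assumes e: "0 < \<epsilon>"
  shows "online_instance 2 2 1 unit_capacity (arrival_law \<epsilon>)"
proof -
  note g = arrival_measurable[OF e]
  have r: "integrable (arrival_law \<epsilon>) (\<lambda>\<xi>. fst \<xi> j)" if "j \<in> {1..2}" for j
    unfolding arrival_law_def integrable_distr_eq[OF g measurable_item_reward[OF that]]
    by (rule integrable_measure_pmf_finite) simp
  have a: "integrable (arrival_law \<epsilon>) (\<lambda>\<xi>. snd \<xi> j k)" if "j \<in> {1..2}" "k \<in> {1..1}" for j k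
    unfolding arrival_law_def integrable_distr_eq[OF g measurable_item_consumption[OF that]]
    by (rule integrable_measure_pmf_finite) simp
  show ?thesis
    unfolding online_instance_def
    using r a e by (simp add: unit_capacity_in_space prob_space_arrival_law sets_arrival_law)
qed

theorem proposition2:
  fixes M :: real
  assumes "M > 0"
  shows "\<exists>T m d b D. online_instance T m d b D \<and>
    (\<forall>\<rho>. exact_solver m d \<rho> \<longrightarrow>
       ce_reward T m d b D \<rho> > 0 \<and>
       (\<forall>\<sigma>. equivariant_solver m d \<sigma> \<longrightarrow>
          oso_reward T m d b D \<sigma> \<ge> M * ce_reward T m d b D \<rho>))"
proof -
  \<comment> \<open>Solves \<open>3 M \<epsilon>\<^sup>2 = \<epsilon> (1 - \<epsilon>)\<close>.\<close>
  define \<epsilon> where "\<epsilon> = 1 / (3 * M + 1)"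
  have e: "0 < \<epsilon>" "\<epsilon> < 1" using assms by (simp_all add: \<epsilon>_def)
  have eq: "M * (3 * \<epsilon>\<^sup>2) = \<epsilon> * (1 - \<epsilon>)"
    using assms by (simp add: \<epsilon>_def power2_eq_square divide_simps)
  have "0 < ce_reward 2 2 1 unit_capacity (arrival_law \<epsilon>) \<rho> \<and>
      (\<forall>\<sigma>. equivariant_solver 2 1 \<sigma> \<longrightarrow>
        M * ce_reward 2 2 1 unit_capacity (arrival_law \<epsilon>) \<rho>
          \<le> oso_reward 2 2 1 unit_capacity (arrival_law \<epsilon>) \<sigma>)"
    if \<rho>: "exact_solver 2 1 \<rho>" for \<rho>
  proof (intro conjI allI impI)
    note ce = ce_reward_bounds[OF e \<rho>]
    have "0 < \<epsilon>\<^sup>2" using e by simp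
    then show "0 < ce_reward 2 2 1 unit_capacity (arrival_law \<epsilon>) \<rho>" using ce(1) by linarith
    fix \<sigma> assume "equivariant_solver 2 1 \<sigma>"
    then have \<sigma>: "exact_solver 2 1 \<sigma>" by (simp add: equivariant_solver_def)
    have "M * ce_reward 2 2 1 unit_capacity (arrival_law \<epsilon>) \<rho> \<le> M * (3 * \<epsilon>\<^sup>2)"
      using ce(2) assms by (intro mult_left_mono) auto
    also have "\<dots> \<le> oso_reward 2 2 1 unit_capacity (arrival_law \<epsilon>) \<sigma>"
      unfolding eq by (rule oso_reward_bound[OF e \<sigma>])
    finally show "M * ce_reward 2 2 1 unit_capacity (arrival_law \<epsilon>) \<rho>
      \<le> oso_reward 2 2 1 unit_capacity (arrival_law \<epsilon>) \<sigma>" .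
  qed
  then show ?thesis using online_instance_arrival_law[OF e(1)] by blast
qed

end
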